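(* For all integers $m\ge 0$ and $n\ge 1$, writing $U_k=T_{k}^{(s_{1,0}^{(n)},s_{1,1}^{(n)},s_{1,2}^{(n)})}$, \begin{align*} \frac{1}{(A_1^{(n)})^3}\sum_{\substack{k_1+k_2+k_3=m\\ k_1,k_2,k_3\ge 0}}\binom{m}{k_1,k_2,k_3}U_{k_1}U_{k_2}U_{k_3} &=-\frac{2}{A_1^{(3n)}}3^m T_{m}^{(s_{1,0}^{(3n)},s_{1,1}^{(3n)},s_{1,2}^{(3n)})}+\frac{6}{44^n}\\ &\quad+\frac{3}{A_1^{(2n)}A_1^{(n)}}\sum_{k=0}^m\binom{m}{k}2^{k}T_{k}^{(s_{1,0}^{(2n)},s_{1,1}^{(2n)},s_{1,2}^{(2n)})}U_{m-k}. \end{align*}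
   Context: Let $\alpha,\beta,\gamma$ be the three distinct complex roots of $x^3-x^2-x-1=0$, and set $c_1=\frac{\alpha}{(\alpha-\beta)(\alpha-\gamma)}$, $c_2=\frac{\beta}{(\beta-\alpha)(\beta-\gamma)}$, $c_3=\frac{\gamma}{(\gamma-\alpha)(\gamma-\beta)}$. For numbers $s_0,s_1,s_2$, the sequence $T_k^{(s_0,s_1,s_2)}$ is defined by $T_0^{(s_0,s_1,s_2)}=s_0$, $T_1^{(s_0,s_1,s_2)}=s_1$, $T_2^{(s_0,s_1,s_2)}=s_2$ and $T_k^{(s_0,s_1,s_2)}=T_{k-1}^{(s_0,s_1,s_2)}+T_{k-2}^{(s_0,s_1,s_2)}+T_{k-3}^{(s_0,s_1,s_2)}$ for $k\ge3$. For each integer $N\ge1$, let $A_1^{(N)}\neq0$ and $s_{1,0}^{(N)},s_{1,1}^{(N)},s_{1,2}^{(N)}$ be numbers such that $c_1^Ne^{\alpha x}+c_2^Ne^{\beta x}+c_3^Ne^{\gamma x}=\frac{1}{A_1^{(N)}}\sum_{k\ge0}T_k^{(s_{1,0}^{(N)},s_{1,1}^{(N)},s_{1,2}^{(N)})}\frac{x^k}{k!}$ (in the paper these are specific integer normalizations). $\binom{m}{k_1,\dots,k_r}=\frac{m!}{k_1!\cdots k_r!}$ is the multinomial coefficient. *)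

theory Defs
  imports Complex_Main
begin

fun trib :: "'a::plus \<Rightarrow> 'a \<Rightarrow> 'a \<Rightarrow> nat \<Rightarrow> 'a" where
  "trib s0 s1 s2 0 = s0"
| "trib s0 s1 s2 (Suc 0) = s1"
| "trib s0 s1 s2 (Suc (Suc 0)) = s2"
| "trib s0 s1 s2 (Suc (Suc (Suc k))) =
     trib s0 s1 s2 (Suc (Suc k)) + trib s0 s1 s2 (Suc k) + trib s0 s1 s2 k"

lemma norm_trib_le:
  fixes s0 s1 s2 :: complex
  shows "norm (trib s0 s1 s2 k) \<le> (norm s0 + norm s1 + norm s2) * 3 ^ k"
proof (induction s0 s1 s2 k rule: trib.induct)
  case (4 s0 s1 s2 k)
  let ?M = "norm s0 + norm s1 + norm s2"
  have "norm (trib s0 s1 s2 (Suc (Suc (Suc k)))) \<le>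
      ?M * 3 ^ Suc (Suc k) + ?M * 3 ^ Suc k + ?M * 3 ^ k"
    unfolding trib.simps using 4 by (intro norm_triangle_mono)
  also have "\<dots> = 13 * (?M * 3 ^ k)"
    by (simp add: algebra_simps)
  also have "\<dots> \<le> 27 * (?M * 3 ^ k)"
    by (intro mult_right_mono) auto
  also have "\<dots> = ?M * 3 ^ Suc (Suc (Suc k))"
    by (simp add: algebra_simps)
  finally show ?case .
qed auto

text \<open>The exponential generating function of such a sequence converges everywhere, so
  writing it with \<^const>\<open>suminf\<close> never yields an unspecified value.\<close>

lemma summable_trib_egf:
  fixes s0 s1 s2 x :: complex
  shows "summable (\<lambda>k. trib s0 s1 s2 k * x ^ k / fact k)"
proof (rule summable_comparison_test)
  let ?M = "norm s0 + norm s1 + norm s2"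
  show "summable (\<lambda>k. ?M * (inverse (fact k) * (3 * norm x) ^ k))"
    by (intro summable_mult summable_exp)
  have "norm (trib s0 s1 s2 k * x ^ k / fact k) \<le> ?M * (inverse (fact k) * (3 * norm x) ^ k)"
    for k
  proof -
    have "norm (trib s0 s1 s2 k * x ^ k / fact k) =
        norm (trib s0 s1 s2 k) * (norm x ^ k / fact k)"
      by (simp add: norm_mult norm_divide norm_power)
    also have "\<dots> \<le> (?M * 3 ^ k) * (norm x ^ k / fact k)"
      by (intro mult_right_mono norm_trib_le) auto
    finally show ?thesis
      by (simp add: field_simps power_mult_distrib)
  qed
  then show "\<exists>N. \<forall>k\<ge>N. norm (trib s0 s1 s2 k * x ^ k / fact k)
      \<le> ?M * (inverse (fact k) * (3 * norm x) ^ k)"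
    by blast
qed

end

theory Submission
  imports Defs "HOL-Analysis.FPS_Convergence"
begin

text \<open>
  By uniqueness of power series, the exponential generating function of the \<open>N\<close>-th sequence
  divided by \<open>A N\<close> is the formal series
  \<open>F\<^sub>N(X) = c\<^sub>1\<^bsup>N\<^esup> e\<^bsup>\<alpha>X\<^esup> + c\<^sub>2\<^bsup>N\<^esup> e\<^bsup>\<beta>X\<^esup> + c\<^sub>3\<^bsup>N\<^esup> e\<^bsup>\<gamma>X\<^esup>\<close>. The power sums of its three summands for
  \<open>N = n\<close> are \<open>p\<^sub>1 = F\<^sub>n(X)\<close>, \<open>p\<^sub>2 = F\<^bsub>2n\<^esub>(2X)\<close> and \<open>p\<^sub>3 = F\<^bsub>3n\<^esub>(3X)\<close>, and their product is
  \<open>e\<^sub>3 = (c\<^sub>1c\<^sub>2c\<^sub>3)\<^sup>n e\<^sup>X\<close> because \<open>\<alpha> + \<beta> + \<gamma> = 1\<close>. Since \<open>\<alpha>\<beta>\<gamma> = 1\<close> and the cubic has discriminant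
  \<open>-44\<close>, we have \<open>c\<^sub>1c\<^sub>2c\<^sub>3 = 1/44\<close>. The theorem is the coefficient of \<open>X\<^sup>m/m!\<close> in Newton's identity
  \<open>p\<^sub>1\<^sup>3 = -2p\<^sub>3 + 6e\<^sub>3 + 3p\<^sub>2p\<^sub>1\<close>.
\<close>

unbundle no vec_syntax
unbundle fps_syntax

lemma has_fps_expansion_unique:
  fixes F G :: "complex fps"
  assumes "f has_fps_expansion F" "f has_fps_expansion G"
  shows "F = G"
  using assms by (intro fps_ext) (simp add: fps_nth_fps_expansion)

lemma fps_cube_nth:
  fixes F :: "'a::comm_semiring_1 fps"
  shows "(F ^ 3) $ m =
    (\<Sum>(k1, k2, k3) \<in> {(k1, k2, k3). k1 + k2 + k3 = m}. F $ k1 * F $ k2 * F $ k3)"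
proof -
  have "(F ^ 3) $ m = (F * F * F) $ m"
    by (simp add: power3_eq_cube)
  also have "\<dots> = (\<Sum>i=0..m. \<Sum>j=0..i. F $ j * F $ (i - j) * F $ (m - i))"
    by (simp add: fps_mult_nth sum_distrib_right)
  also have "\<dots> = (\<Sum>(i, j) \<in> (SIGMA i:{0..m}. {0..i}). F $ j * F $ (i - j) * F $ (m - i))"
    by (subst sum.Sigma) auto
  \<comment> \<open>The triples are parametrised by the partial sums i = k1 + k2 and j = k1.\<close>
  also have "\<dots> = (\<Sum>(k1, k2, k3) \<in> {(k1, k2, k3). k1 + k2 + k3 = m}. F $ k1 * F $ k2 * F $ k3)"
    by (rule sum.reindex_bij_witness[where
          i = "\<lambda>(k1, k2, k3). (k1 + k2, k1)" and j = "\<lambda>(i, j). (j, i - j, m - i)"]) auto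
  finally show ?thesis .
qed

text \<open>Scaling by factorials turns the Cauchy product into the binomial convolution of
  exponential generating functions.\<close>

lemma fact_times_fps_mult_nth:
  fixes F G :: "'a::field_char_0 fps"
  shows "fact m * (F * G) $ m =
    (\<Sum>k=0..m. of_nat (m choose k) * (fact k * F $ k) * (fact (m - k) * G $ (m - k)))"
  unfolding fps_mult_nth sum_distrib_left
  by (intro sum.cong) (auto simp: binomial_fact)

lemma power_sum_identity_3:
  fixes x y z :: "'a::comm_ring_1"
  shows "(x + y + z) ^ 3 =
    - 2 * (x ^ 3 + y ^ 3 + z ^ 3) + 6 * (x * y * z) + 3 * ((x ^ 2 + y ^ 2 + z ^ 2) * (x + y + z))"
  by (simp add: power2_eq_square power3_eq_cube algebra_simps)

context
  fixes \<alpha> \<beta> \<gamma> :: complex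
  assumes roots: "{x :: complex. x ^ 3 - x ^ 2 - x - 1 = 0} = {\<alpha>, \<beta>, \<gamma>}"
    and distinct: "\<alpha> \<noteq> \<beta>" "\<alpha> \<noteq> \<gamma>" "\<beta> \<noteq> \<gamma>"
begin

lemma tribonacci_root_eqs:
  "\<alpha> ^ 3 - \<alpha> ^ 2 - \<alpha> - 1 = 0" "\<beta> ^ 3 - \<beta> ^ 2 - \<beta> - 1 = 0" "\<gamma> ^ 3 - \<gamma> ^ 2 - \<gamma> - 1 = 0"
  using roots by auto

text \<open>This is the divided difference of the cubic at \<alpha> and \<beta>, where the cubic
  vanishes.\<close>

lemma tribonacci_roots_quotient: "\<alpha> ^ 2 + \<alpha> * \<beta> + \<beta> ^ 2 - \<alpha> - \<beta> - 1 = 0"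
proof -
  have "(\<alpha> - \<beta>) * (\<alpha> ^ 2 + \<alpha> * \<beta> + \<beta> ^ 2 - \<alpha> - \<beta> - 1) = 0"
    using tribonacci_root_eqs by algebra
  then show ?thesis
    using distinct by simp
qed

lemma tribonacci_roots_sum: "\<alpha> + \<beta> + \<gamma> = 1"
proof -
  \<comment> \<open>Newton interpolation at \<alpha>, \<beta>: the lower terms vanish, and the
    second divided difference is \<alpha> + \<beta> + \<gamma> - 1.\<close>
  have "(\<alpha> - \<gamma>) * (\<beta> - \<gamma>) * (\<alpha> + \<beta> + \<gamma> - 1) = 0"
    using tribonacci_root_eqs tribonacci_roots_quotient by algebra
  then show ?thesis
    using distinct by simp
qed

text \<open>Given sum 1, the quotient relation makes the second elementary symmetric function -1.
  Expanding (x - \<alpha>)(x - \<beta>)(x - \<gamma>) at x = \<alpha> then yields the product as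
  \<alpha>^3 - \<alpha>^2 - \<alpha>.\<close>

lemma tribonacci_roots_prod: "\<alpha> * \<beta> * \<gamma> = 1"
  using tribonacci_root_eqs tribonacci_roots_quotient tribonacci_roots_sum by algebra

lemma tribonacci_discriminant: "((\<alpha> - \<beta>) * (\<alpha> - \<gamma>) * (\<beta> - \<gamma>)) ^ 2 = - 44"
proof -
  have \<gamma>: "\<gamma> = 1 - \<alpha> - \<beta>"
    using tribonacci_roots_sum by (simp add: algebra_simps)
  show ?thesis
    using tribonacci_root_eqs(1) tribonacci_roots_quotient unfolding \<gamma> by algebra
qed

lemma tribonacci_coeffs_prod:
  "\<alpha> / ((\<alpha> - \<beta>) * (\<alpha> - \<gamma>)) * (\<beta> / ((\<beta> - \<alpha>) * (\<beta> - \<gamma>))) * (\<gamma> / ((\<gamma> - \<alpha>) * (\<gamma> - \<beta>))) = 1 / 44"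
proof -
  \<comment> \<open>Three of the six differences are reversed, which gives the sign.\<close>
  have "(\<alpha> - \<beta>) * (\<alpha> - \<gamma>) * ((\<beta> - \<alpha>) * (\<beta> - \<gamma>)) * ((\<gamma> - \<alpha>) * (\<gamma> - \<beta>)) =
      - (((\<alpha> - \<beta>) * (\<alpha> - \<gamma>) * (\<beta> - \<gamma>)) ^ 2)"
    by algebra
  then show ?thesis
    by (simp only: times_divide_times_eq tribonacci_discriminant tribonacci_roots_prod) simp
qed

end

theorem theorem8:
  fixes \<alpha> \<beta> \<gamma> c1 c2 c3 :: complex
    and A s0 s1 s2 :: "nat \<Rightarrow> complex"
    and m n :: nat
  assumes roots: "{x :: complex. x ^ 3 - x ^ 2 - x - 1 = 0} = {\<alpha>, \<beta>, \<gamma>}"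
    and distinct: "\<alpha> \<noteq> \<beta>" "\<alpha> \<noteq> \<gamma>" "\<beta> \<noteq> \<gamma>"
    and c1: "c1 = \<alpha> / ((\<alpha> - \<beta>) * (\<alpha> - \<gamma>))"
    and c2: "c2 = \<beta> / ((\<beta> - \<alpha>) * (\<beta> - \<gamma>))"
    and c3: "c3 = \<gamma> / ((\<gamma> - \<alpha>) * (\<gamma> - \<beta>))"
    and A_nonzero: "\<And>N. N \<ge> 1 \<Longrightarrow> A N \<noteq> 0"
    and egf: "\<And>N x. N \<ge> 1 \<Longrightarrow>
      c1 ^ N * exp (\<alpha> * x) + c2 ^ N * exp (\<beta> * x) + c3 ^ N * exp (\<gamma> * x) =
      1 / A N * (\<Sum>k. trib (s0 N) (s1 N) (s2 N) k * x ^ k / fact k)"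
    and n: "n \<ge> 1"
  shows "1 / A n ^ 3 *
      (\<Sum>(k1, k2, k3) \<in> {(k1, k2, k3). k1 + k2 + k3 = m}.
        fact m / (fact k1 * fact k2 * fact k3) *
        trib (s0 n) (s1 n) (s2 n) k1 * trib (s0 n) (s1 n) (s2 n) k2 *
        trib (s0 n) (s1 n) (s2 n) k3) =
    - (2 / A (3 * n)) * 3 ^ m * trib (s0 (3 * n)) (s1 (3 * n)) (s2 (3 * n)) m
    + 6 / 44 ^ n
    + 3 / (A (2 * n) * A n) *
      (\<Sum>k = 0..m. of_nat (m choose k) * 2 ^ k *
        trib (s0 (2 * n)) (s1 (2 * n)) (s2 (2 * n)) k *
        trib (s0 n) (s1 n) (s2 n) (m - k))"
proof -
  define U where "U N = trib (s0 N) (s1 N) (s2 N)" for N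
  define F where "F N = fps_const (c1 ^ N) * fps_exp \<alpha> + fps_const (c2 ^ N) * fps_exp \<beta> +
    fps_const (c3 ^ N) * fps_exp \<gamma>" for N
  define x y z where "x = fps_const (c1 ^ n) * fps_exp \<alpha>" and "y = fps_const (c2 ^ n) * fps_exp \<beta>"
    and "z = fps_const (c3 ^ n) * fps_exp \<gamma>"

  have F_nth: "fact k * F N $ k = U N k / A N" if "N \<ge> 1" for N k
  proof -
    let ?f = "\<lambda>x. c1 ^ N * exp (\<alpha> * x) + c2 ^ N * exp (\<beta> * x) + c3 ^ N * exp (\<gamma> * x)"
    let ?G = "Abs_fps (\<lambda>k. U N k / (A N * fact k))"
    have "?f has_fps_expansion F N"
      unfolding F_def by (intro fps_expansion_intros)
    moreover have "?f has_fps_expansion ?G"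
    proof (rule has_fps_expansionI, rule always_eventually, rule allI)
      fix u
      \<comment> \<open>Convergence at every \<open>u\<close> lets the \<open>suminf\<close> in
        \<open>egf\<close> be read as a genuine sum.\<close>
      have "(\<lambda>k. 1 / A N * (U N k * u ^ k / fact k)) sums ?f u"
        unfolding egf[OF that] U_def by (intro sums_mult summable_sums summable_trib_egf)
      then show "(\<lambda>k. ?G $ k * u ^ k) sums ?f u"
        by simp
    qed
    ultimately have "F N = ?G"
      by (rule has_fps_expansion_unique)
    then show ?thesis
      by simp
  qed

  have F1: "x + y + z = F n"
    by (simp add: F_def x_def y_def z_def)
  \<comment> \<open>The r-th power of e^(aX) is e^(raX), so substituting rX for X contributes r^k to
    the k-th coefficient.\<close>
  have power_nth: "((fps_const (c ^ n) * fps_exp a) ^ r) $ k =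
      of_nat r ^ k * (fps_const (c ^ (r * n)) * fps_exp a) $ k" for c a :: complex and r k
    by (simp add: power_mult_distrib fps_exp_power_mult fps_const_power flip: power_mult)
       (simp add: mult.commute)
  have F2: "(x ^ 2 + y ^ 2 + z ^ 2) $ k = 2 ^ k * F (2 * n) $ k" for k
    by (simp add: x_def y_def z_def power_nth F_def distrib_left del: fps_mult_left_const_nth)
  have F3: "(x ^ 3 + y ^ 3 + z ^ 3) $ k = 3 ^ k * F (3 * n) $ k" for k
    by (simp add: x_def y_def z_def power_nth F_def distrib_left del: fps_mult_left_const_nth)
  have c_prod: "c1 * c2 * c3 = 1 / 44"
    unfolding c1 c2 c3 by (rule tribonacci_coeffs_prod[OF roots distinct])
  have "c1 ^ n * c2 ^ n * c3 ^ n = 1 / 44 ^ n"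
    by (simp only: c_prod power_one_over flip: power_mult_distrib)
  moreover have "x * y * z = fps_const (c1 ^ n * c2 ^ n * c3 ^ n) * fps_exp (\<alpha> + \<beta> + \<gamma>)"
    by (simp add: x_def y_def z_def fps_exp_add_mult mult_ac flip: fps_const_mult)
  ultimately have xyz: "fact m * (x * y * z) $ m = 1 / 44 ^ n"
    by (simp add: tribonacci_roots_sum[OF roots distinct])

  have "1 / A n ^ 3 * (\<Sum>(k1, k2, k3) \<in> {(k1, k2, k3). k1 + k2 + k3 = m}.
      fact m / (fact k1 * fact k2 * fact k3) * U n k1 * U n k2 * U n k3) = fact m * (F n ^ 3) $ m"
  proof -
    \<comment> \<open>In this form the three factors \<open>A n\<close> cancel the prefactor and the
      factorials cancel the multinomial denominator.\<close>
    have U: "U n k = A n * (fact k * F n $ k)" for k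
      using F_nth[OF n] A_nonzero[OF n] by simp
    show ?thesis
      unfolding fps_cube_nth sum_distrib_left
      by (intro sum.cong) (auto simp: U power3_eq_cube A_nonzero[OF n])
  qed
  also have "F n ^ 3 = - 2 * (x ^ 3 + y ^ 3 + z ^ 3) + 6 * (x * y * z) +
      3 * ((x ^ 2 + y ^ 2 + z ^ 2) * F n)"
    using power_sum_identity_3[of x y z] by (simp add: F1)
  also have "fact m * \<dots> $ m = - 2 * 3 ^ m * (fact m * F (3 * n) $ m) + 6 * (fact m * (x * y * z) $ m) +
      3 * (fact m * ((x ^ 2 + y ^ 2 + z ^ 2) * F n) $ m)"
  proof -
    have "fact m * (- 2 * P + 6 * Q + 3 * R) $ m =
        - 2 * (fact m * P $ m) + 6 * (fact m * Q $ m) + 3 * (fact m * R $ m)"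
      for P Q R :: "complex fps"
      by (simp add: distrib_left right_diff_distrib)
    then show ?thesis
      by (simp only: F3 mult.assoc mult.left_commute[of "fact m" "3 ^ m"])
  qed
  also have "\<dots> = - (2 / A (3 * n)) * 3 ^ m * U (3 * n) m + 6 / 44 ^ n +
      3 / (A (2 * n) * A n) *
        (\<Sum>k = 0..m. of_nat (m choose k) * 2 ^ k * U (2 * n) k * U n (m - k))"
  proof -
    have "fact m * ((x ^ 2 + y ^ 2 + z ^ 2) * F n) $ m =
        (\<Sum>k=0..m. of_nat (m choose k) * (2 ^ k * (fact k * F (2 * n) $ k)) *
          (fact (m - k) * F n $ (m - k)))"
      unfolding fact_times_fps_mult_nth F2 by (simp add: mult_ac)
    also have "\<dots> = 1 / (A (2 * n) * A n) *
        (\<Sum>k = 0..m. of_nat (m choose k) * 2 ^ k * U (2 * n) k * U n (m - k))"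
      using n by (simp add: F_nth sum_distrib_left mult_ac)
    finally show ?thesis
      using n by (simp add: xyz F_nth)
  qed
  finally show ?thesis
    unfolding U_def .
qed

end
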